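(* For all integers $g\ge 0$, there is an injection $$\mathcal F(g,3)\longrightarrow\mathcal F(g+1,3).$$ In particular, $n_{g+1,3}\ge n_{g,3}$ for all $g\ge 0$.
   Context: Notation: $\mathbb N=\{0,1,2,\dots\}$, $\mathbb N_+=\{1,2,\dots\}$, and $[a,b]$ denotes the integer interval $\{z\in\mathbb Z: a\le z\le b\}$. A numerical semigroup is a subset $S\subseteq\mathbb N$ containing $0$, stable under addition and with finite complement in $\mathbb N$. Its genus is $|\mathbb N\setminus S|$ and its multiplicity is $\min(S\setminus\{0\})$. For integers $g\ge 0$, $m\ge 1$, $n_{g,m}$ denotes the (finite) number of numerical semigroups of genus $g$ and multiplicity $m$. A gapset is a finite set $G\subset\mathbb N_+$ such that for all $z\in G$, if $z=x+y$ with $x,y\in\mathbb N_+$, then $x\in G$ or $y\in G$ (equivalently, $\mathbb N\setminus G$ is a numerical semigroup). Its multiplicity is the smallest integer $m\ge 1$ with $m\notin G$; its genus is $|G|$; its conductor is $c=1+\max(G)$ if $G\ne\emptyset$ and $c=0$ otherwise; its depth is $q=\lceil c/m\rceil$. For a gapset $G$ of multiplicity $m$ and depth $q$, put $G_i=G\cap[im+1,(i+1)m-1]$ and $F_i=-im+G_i=\{x-im: x\in G_i\}$ for $0\le i\le q-1$. The gapset filtration associated to $G$ is the finite sequence $(F_0,F_1,\dots,F_{q-1})$; its multiplicity and genus are those of $G$ (so its genus is $\sum_i|F_i|$). $\mathcal F(g,m)$ denotes the set of all gapset filtrations of genus $g$ and multiplicity $m$. *)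

theory Defs
  imports Complex_Main
begin

section \<open>Numerical semigroups\<close>

definition numerical_semigroup :: "nat set \<Rightarrow> bool" where
  "numerical_semigroup S \<longleftrightarrow>
     0 \<in> S \<and> (\<forall>x\<in>S. \<forall>y\<in>S. x + y \<in> S) \<and> finite (UNIV - S)"

definition semigroup_genus :: "nat set \<Rightarrow> nat" where
  "semigroup_genus S = card (UNIV - S)"

definition semigroup_multiplicity :: "nat set \<Rightarrow> nat" where
  "semigroup_multiplicity S = (LEAST x. x \<in> S - {0})"

definition numerical_semigroups :: "nat \<Rightarrow> nat \<Rightarrow> nat set set" where
  "numerical_semigroups g m =
     {S. numerical_semigroup S \<and> semigroup_genus S = g \<and> semigroup_multiplicity S = m}"

text \<open>The cardinality below is a genuine count, by \<open>finite_numerical_semigroups\<close>.\<close>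

definition num_semigroups :: "nat \<Rightarrow> nat \<Rightarrow> nat" where
  "num_semigroups g m = card (numerical_semigroups g m)"

lemma semigroup_multiplicity_in:
  assumes "numerical_semigroup S"
  shows "semigroup_multiplicity S \<in> S" "0 < semigroup_multiplicity S"
proof -
  have fin: "finite (UNIV - S)"
    using assms by (simp add: numerical_semigroup_def)
  have "S - {0} \<noteq> {}"
  proof
    assume "S - {0} = {}"
    then have "UNIV \<subseteq> insert 0 (UNIV - S)" by auto
    with fin have "finite (UNIV :: nat set)" by (meson finite.insertI finite_subset)
    then show False by simp
  qed
  then obtain x where "x \<in> S - {0}" by blast
  then have "semigroup_multiplicity S \<in> S - {0}"
    unfolding semigroup_multiplicity_def by (rule LeastI)
  then show "semigroup_multiplicity S \<in> S" "0 < semigroup_multiplicity S" by auto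
qed

lemma gap_bound:
  assumes S: "numerical_semigroup S" and x: "x \<notin> S"
  shows "x < semigroup_multiplicity S * (semigroup_genus S + 1)"
proof (rule ccontr)
  let ?m = "semigroup_multiplicity S" and ?g = "semigroup_genus S"
  assume "\<not> x < ?m * (?g + 1)"
  then have le: "?m * (?g + 1) \<le> x" by simp
  have mult: "k * ?m \<in> S" for k
    using S semigroup_multiplicity_in(1)[OF S]
    by (induction k) (auto simp: numerical_semigroup_def)
  have kx: "k * ?m \<le> x" if "k \<le> ?g" for k
    using le that by (metis add.commute le_trans mult.commute mult_le_mono1 trans_le_add2)
  have "x - k * ?m \<notin> S" if "k \<le> ?g" for k
  proof
    assume "x - k * ?m \<in> S"
    then have "(x - k * ?m) + k * ?m \<in> S"
      using S mult[of k] by (auto simp: numerical_semigroup_def)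
    with kx[OF that] x show False by simp
  qed
  then have sub: "(\<lambda>k. x - k * ?m) ` {..?g} \<subseteq> UNIV - S" by auto
  have "inj_on (\<lambda>k. x - k * ?m) {..?g}"
  proof (rule inj_onI)
    fix a b assume ab: "a \<in> {..?g}" "b \<in> {..?g}" "x - a * ?m = x - b * ?m"
    then have "a * ?m \<le> x" "b * ?m \<le> x" using kx by simp_all
    with ab(3) have "a * ?m = b * ?m" by linarith
    with semigroup_multiplicity_in(2)[OF S] show "a = b" by simp
  qed
  then have "card ((\<lambda>k. x - k * ?m) ` {..?g}) = ?g + 1"
    by (simp add: card_image)
  moreover have "card ((\<lambda>k. x - k * ?m) ` {..?g}) \<le> ?g"
    using sub S card_mono unfolding semigroup_genus_def numerical_semigroup_def by blast
  ultimately show False by simp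
qed

lemma finite_numerical_semigroups: "finite (numerical_semigroups g m)"
proof (rule finite_subset)
  show "numerical_semigroups g m \<subseteq> (\<lambda>G. UNIV - G) ` Pow {..<m * (g + 1)}"
  proof
    fix S assume "S \<in> numerical_semigroups g m"
    then have "UNIV - S \<subseteq> {..<m * (g + 1)}"
      using gap_bound by (auto simp: numerical_semigroups_def)
    moreover have "S = UNIV - (UNIV - S)" by auto
    ultimately show "S \<in> (\<lambda>G. UNIV - G) ` Pow {..<m * (g + 1)}" by blast
  qed
qed simp


section \<open>Gapsets and gapset filtrations\<close>

definition gapset :: "nat set \<Rightarrow> bool" where
  "gapset G \<longleftrightarrow> finite G \<and> 0 \<notin> G \<and>
     (\<forall>z\<in>G. \<forall>x y. 1 \<le> x \<and> 1 \<le> y \<and> z = x + y \<longrightarrow> x \<in> G \<or> y \<in> G)"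

definition gapset_multiplicity :: "nat set \<Rightarrow> nat" where
  "gapset_multiplicity G = (LEAST m. 1 \<le> m \<and> m \<notin> G)"

definition gapset_genus :: "nat set \<Rightarrow> nat" where
  "gapset_genus G = card G"

definition conductor :: "nat set \<Rightarrow> nat" where
  "conductor G = (if G = {} then 0 else 1 + Max G)"

definition depth :: "nat set \<Rightarrow> nat" where
  "depth G = nat \<lceil>real (conductor G) / real (gapset_multiplicity G)\<rceil>"

definition gapset_layer :: "nat set \<Rightarrow> nat \<Rightarrow> nat set" where
  "gapset_layer G i =
     (let m = gapset_multiplicity G in G \<inter> {i * m + 1 .. (i + 1) * m - 1})"

text \<open>
  Both subtractions on naturals, here and in \<open>gapset_layer\<close>, are exact: the multiplicity of a
  gapset is at least 1, and every element of layer \<open>i\<close> exceeds \<open>i\<close> times the multiplicity.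
\<close>

definition filtration_layer :: "nat set \<Rightarrow> nat \<Rightarrow> nat set" where
  "filtration_layer G i = (\<lambda>x. x - i * gapset_multiplicity G) ` gapset_layer G i"

definition gapset_filtration :: "nat set \<Rightarrow> nat set list" where
  "gapset_filtration G = map (filtration_layer G) [0..<depth G]"

text \<open>
  The genus and multiplicity of a filtration are, by definition, those of its gapset. The gapset
  can be recovered from the filtration, so this is unambiguous.
\<close>

definition gapset_filtrations :: "nat \<Rightarrow> nat \<Rightarrow> nat set list set" where
  "gapset_filtrations g m =
     gapset_filtration ` {G. gapset G \<and> gapset_genus G = g \<and> gapset_multiplicity G = m}"

end

theory Submission
  imports Defs
begin

text \<open>
  A gapset of multiplicity 3 contains no multiple of 3, and with an element \<open>x > 3\<close> it contains
  \<open>x - 3\<close>. It is therefore determined by the numbers \<open>a\<close> and \<open>b\<close> of its elements congruent to 1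
  and to 2 modulo 3, its Kunz coordinates. Write \<open>S\<close> for the complement. The least elements of
  \<open>S\<close> in these two classes are \<open>3 a + 1\<close> and \<open>3 b + 2\<close>, and \<open>S\<close> is closed under addition if and
  only if it contains their doubles \<open>3 (2 a) + 2\<close> and \<open>3 (2 b + 1) + 1\<close>, that is, if and only if
  \<open>b \<le> 2 a\<close> and \<open>a \<le> 2 b + 1\<close>. So gapsets of multiplicity 3 and genus \<open>g\<close> correspond to the
  lattice points with \<open>a + b = g\<close> in a planar cone (\<open>bij_betw_kunz_points\<close>).

  Increasing one coordinate by 1 moves such a point to the next antidiagonal, and it can leave the
  cone only from a boundary line: \<open>(a, b + 1)\<close> is outside only for \<open>b = 2 a\<close>, hence \<open>g = 3 a\<close>,
  and \<open>(a + 1, b)\<close> is outside only for \<open>a = 2 b + 1\<close>, hence \<open>g = 3 b + 1\<close>. Since \<open>g\<close> cannot be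
  congruent to both 0 and 1 modulo 3, one of the two translations maps the whole antidiagonal into
  the cone (\<open>card_kunz_points_mono\<close>).

  Both assertions follow by counting, because gapsets correspond to their filtrations
  (\<open>inj_on_gapset_filtration\<close>) and, through complements, to numerical semigroups
  (\<open>num_semigroups_eq_card_gapsets\<close>).
\<close>

definition gapsets :: "nat \<Rightarrow> nat \<Rightarrow> nat set set" where
  "gapsets g m = {G. gapset G \<and> gapset_genus G = g \<and> gapset_multiplicity G = m}"

section \<open>Gapsets, semigroups and filtrations\<close>

lemma gapset_multiplicity_props:
  assumes "gapset G"
  shows "1 \<le> gapset_multiplicity G" "gapset_multiplicity G \<notin> G"
proof -
  have "finite (insert 0 G)" using assms by (simp add: gapset_def)
  then obtain x where "x \<notin> insert 0 G" using ex_new_if_finite infinite_UNIV_nat by blast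
  then have "1 \<le> x \<and> x \<notin> G" by simp
  then have "1 \<le> gapset_multiplicity G \<and> gapset_multiplicity G \<notin> G"
    unfolding gapset_multiplicity_def by (rule LeastI)
  then show "1 \<le> gapset_multiplicity G" "gapset_multiplicity G \<notin> G" by auto
qed

lemma gapset_split:
  assumes "gapset G" "x + y \<in> G" "1 \<le> x" "1 \<le> y"
  shows "x \<in> G \<or> y \<in> G"
  using assms unfolding gapset_def by blast

lemma gapset_minus_multiplicity:
  assumes "gapset G" "x + gapset_multiplicity G \<in> G" "1 \<le> x"
  shows "x \<in> G"
  using gapset_split[OF assms(1,2)] gapset_multiplicity_props[OF assms(1)] assms(3) by blast

lemma mult_multiplicity_notin_gapset:
  assumes "gapset G"
  shows "k * gapset_multiplicity G \<notin> G"
proof (induction k)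
  case 0
  then show ?case using assms by (simp add: gapset_def)
next
  case (Suc k)
  show ?case
  proof (cases "k = 0")
    case True
    then show ?thesis using gapset_multiplicity_props[OF assms] by simp
  next
    case False
    then have "1 \<le> k * gapset_multiplicity G" using gapset_multiplicity_props[OF assms] by simp
    then show ?thesis
      using Suc gapset_minus_multiplicity[OF assms, of "k * gapset_multiplicity G"]
      by (auto simp: add.commute)
  qed
qed

lemma div_multiplicity_less_depth:
  assumes "gapset G" "x \<in> G"
  shows "x div gapset_multiplicity G < depth G"
proof -
  let ?m = "gapset_multiplicity G"
  have m: "0 < ?m" using gapset_multiplicity_props[OF assms(1)] by simp
  have c: "x < conductor G"
    using assms by (auto simp: conductor_def gapset_def less_Suc_eq_le)
  have "real (x div ?m) \<le> real x / real ?m" using of_nat_div_le_of_nat[of x ?m] by simp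
  also have "\<dots> < real (conductor G) / real ?m"
    using c m by (simp add: divide_strict_right_mono)
  also have "\<dots> \<le> real (depth G)"
    unfolding depth_def by (rule real_nat_ceiling_ge)
  finally show ?thesis by simp
qed

text \<open>
  Gluing the layers back together recovers the gapset: an element is not a multiple of \<open>m\<close>, so it
  lies strictly between two consecutive multiples, and the depth is large enough for the layers to
  reach the maximum.
\<close>

lemma gapset_eq_layers:
  assumes "gapset G"
  shows "G = (\<Union>i<length (gapset_filtration G).
    (\<lambda>x. x + i * gapset_multiplicity G) ` (gapset_filtration G ! i))"
proof -
  let ?m = "gapset_multiplicity G"
  have m: "0 < ?m" using gapset_multiplicity_props[OF assms] by simp
  have shift: "(\<lambda>x. x + i * ?m) ` filtration_layer G i = gapset_layer G i" for i
  proof -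
    have "(\<lambda>x. x + i * ?m) ` filtration_layer G i = (\<lambda>x. x) ` gapset_layer G i"
      unfolding filtration_layer_def image_image
      by (rule image_cong) (auto simp: gapset_layer_def Let_def)
    then show ?thesis by simp
  qed
  have "x \<in> gapset_layer G (x div ?m)" if x: "x \<in> G" for x
  proof -
    have "x mod ?m \<noteq> 0"
      using x mult_multiplicity_notin_gapset[OF assms, of "x div ?m"]
      by (metis add.right_neutral div_mult_mod_eq)
    moreover have "x = (x div ?m) * ?m + x mod ?m" by simp
    ultimately have "(x div ?m) * ?m + 1 \<le> x" by linarith
    moreover have "x < (x div ?m + 1) * ?m"
      using m dividend_less_div_times[of ?m x] by (simp add: algebra_simps)
    ultimately show ?thesis using x by (auto simp: gapset_layer_def Let_def)
  qed
  then have "G = (\<Union>i<depth G. gapset_layer G i)"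
    using div_multiplicity_less_depth[OF assms] unfolding gapset_layer_def Let_def by blast
  also have "\<dots> = (\<Union>i<length (gapset_filtration G).
    (\<lambda>x. x + i * ?m) ` (gapset_filtration G ! i))"
    by (intro SUP_cong) (auto simp: gapset_filtration_def shift)
  finally show ?thesis .
qed

lemma inj_on_gapset_filtration: "inj_on gapset_filtration (gapsets g m)"
proof (rule inj_onI)
  fix G H
  assume "G \<in> gapsets g m" "H \<in> gapsets g m" and eq: "gapset_filtration G = gapset_filtration H"
  then have G: "gapset G" "gapset_multiplicity G = m" and H: "gapset H" "gapset_multiplicity H = m"
    by (auto simp: gapsets_def)
  show "G = H"
    using gapset_eq_layers[OF G(1)] gapset_eq_layers[OF H(1)] by (simp only: G(2) H(2) eq)
qed

lemma card_gapset_filtrations: "card (gapset_filtrations g m) = card (gapsets g m)"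
  using card_image[OF inj_on_gapset_filtration] by (simp add: gapset_filtrations_def gapsets_def)

text \<open>
  Closure of \<open>S\<close> under addition is the contrapositive of the gapset condition on its complement;
  the two differ only for zero summands, which are harmless since \<open>0 \<in> S\<close>.
\<close>

lemma gapset_Compl_iff: "gapset (- S) \<longleftrightarrow> numerical_semigroup S"
proof
  assume G: "gapset (- S)"
  have "x + y \<in> S" if "x \<in> S" "y \<in> S" for x y
  proof (cases "x = 0 \<or> y = 0")
    case True
    then show ?thesis using that by auto
  next
    case False
    then show ?thesis using gapset_split[OF G, of x y] that by auto
  qed
  then show "numerical_semigroup S"
    using G by (simp add: gapset_def numerical_semigroup_def Compl_eq_Diff_UNIV)
next
  assume "numerical_semigroup S"
  then show "gapset (- S)"
    by (auto simp: gapset_def numerical_semigroup_def Compl_eq_Diff_UNIV[symmetric])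
qed

lemma num_semigroups_eq_card_gapsets: "num_semigroups g m = card (gapsets g m)"
proof -
  have iff: "S \<in> numerical_semigroups g m \<longleftrightarrow> - S \<in> gapsets g m" for S
  proof -
    have "(\<lambda>x. x \<in> S - {0}) = (\<lambda>x. 1 \<le> x \<and> x \<notin> - S)" by (auto simp: fun_eq_iff)
    then have "semigroup_multiplicity S = gapset_multiplicity (- S)"
      unfolding semigroup_multiplicity_def gapset_multiplicity_def by simp
    then show ?thesis
      by (simp add: numerical_semigroups_def gapsets_def gapset_Compl_iff semigroup_genus_def
          gapset_genus_def Compl_eq_Diff_UNIV[symmetric])
  qed
  have "bij_betw uminus (numerical_semigroups g m) (gapsets g m)"
    by (rule bij_betw_byWitness[where f' = uminus]) (simp_all add: image_subset_iff iff)
  then show ?thesis unfolding num_semigroups_def by (rule bij_betw_same_card)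
qed

section \<open>Kunz coordinates in multiplicity 3\<close>

definition kunz_set :: "nat \<Rightarrow> nat \<Rightarrow> nat set" where
  "kunz_set a b = (\<lambda>i. 3 * i + 1) ` {..<a} \<union> (\<lambda>i. 3 * i + 2) ` {..<b}"

definition kunz_points :: "nat \<Rightarrow> (nat \<times> nat) set" where
  "kunz_points g = {(a, b). 1 \<le> a \<and> 1 \<le> b \<and> b \<le> 2 * a \<and> a \<le> 2 * b + 1 \<and> a + b = g}"

lemma kunz_set_mem:
  "3 * i \<notin> kunz_set a b"
  "3 * i + 1 \<in> kunz_set a b \<longleftrightarrow> i < a"
  "3 * i + 2 \<in> kunz_set a b \<longleftrightarrow> i < b"
  unfolding kunz_set_def by (auto simp: image_iff) presburger+

lemma nat_mod_3_cases:
  obtains i :: nat where "x = 3 * i" | i where "x = 3 * i + 1" | i where "x = 3 * i + 2"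
proof -
  have "x = 3 * (x div 3) \<or> x = 3 * (x div 3) + 1 \<or> x = 3 * (x div 3) + 2" by presburger
  then show thesis using that by blast
qed

lemma mem_kunz_set_iff:
  "x \<in> kunz_set a b \<longleftrightarrow> (\<exists>i<a. x = 3 * i + 1) \<or> (\<exists>i<b. x = 3 * i + 2)"
  unfolding kunz_set_def by auto

lemma card_kunz_set: "card (kunz_set a b) = a + b"
proof -
  have "(\<lambda>i. 3 * i + 1) ` {..<a} \<inter> (\<lambda>i. 3 * i + 2) ` {..<b} = {}" by auto presburger
  then show ?thesis
    unfolding kunz_set_def by (subst card_Un_disjoint) (auto simp: card_image inj_on_def)
qed

lemma kunz_set_inject: "kunz_set a b = kunz_set a' b' \<longleftrightarrow> a = a' \<and> b = b'"
proof
  assume eq: "kunz_set a b = kunz_set a' b'"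
  have "i < a \<longleftrightarrow> i < a'" "i < b \<longleftrightarrow> i < b'" for i
    using kunz_set_mem(2,3)[of i a b] kunz_set_mem(2,3)[of i a' b'] eq by auto
  then show "a = a' \<and> b = b'" by (meson nat_neq_iff)
qed simp

text \<open>
  Necessity comes from splitting \<open>3 (2 a) + 2\<close> and \<open>3 (2 b + 1) + 1\<close> into equal halves. For
  sufficiency, consider a sum of two elements of the complement that is not a multiple of 3. If one
  summand is a multiple of 3, the sum lies in the class of the other one and is at least as large;
  otherwise both summands lie in the same class, and the two inequalities apply.
\<close>

lemma gapset_kunz_set_iff: "gapset (kunz_set a b) \<longleftrightarrow> b \<le> 2 * a \<and> a \<le> 2 * b + 1"
proof
  assume G: "gapset (kunz_set a b)"
  have half: "2 * x \<notin> kunz_set a b" if "x \<notin> kunz_set a b" "1 \<le> x" for x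
    using gapset_split[OF G, of x x] that by (auto simp: mult_2)
  have "2 * (3 * a + 1) \<notin> kunz_set a b"
    by (rule half) (use kunz_set_mem(2)[of a a b] in simp_all)
  moreover have "2 * (3 * a + 1) = 3 * (2 * a) + 2" by simp
  ultimately have 1: "3 * (2 * a) + 2 \<notin> kunz_set a b" by metis
  have "2 * (3 * b + 2) \<notin> kunz_set a b"
    by (rule half) (use kunz_set_mem(3)[of b a b] in simp_all)
  moreover have "2 * (3 * b + 2) = 3 * (2 * b + 1) + 1" by simp
  ultimately have 2: "3 * (2 * b + 1) + 1 \<notin> kunz_set a b" by metis
  from 1 2 show "b \<le> 2 * a \<and> a \<le> 2 * b + 1"
    unfolding kunz_set_mem by simp
next
  assume ab: "b \<le> 2 * a \<and> a \<le> 2 * b + 1"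
  have "x \<in> kunz_set a b \<or> y \<in> kunz_set a b" if xy: "x + y \<in> kunz_set a b" for x y
  proof (rule ccontr)
    assume "\<not> ?thesis"
    then have notin: "x \<notin> kunz_set a b" "y \<notin> kunz_set a b" by auto
    consider k where "k < a" "x + y = 3 * k + 1" | k where "k < b" "x + y = 3 * k + 2"
      using xy unfolding mem_kunz_set_iff by blast
    \<comment> \<open>Modulo 3, summands in the classes \<open>r\<close> and \<open>s\<close> with \<open>r + s\<close> in the wrong class are
      impossible; in the other cases \<open>notin\<close> and \<open>ab\<close> bound \<open>k\<close> linearly from below.\<close>
    then show False
    proof cases
      case 1
      show False
        by (cases x rule: nat_mod_3_cases; cases y rule: nat_mod_3_cases;
            ((insert 1(2); presburger) |
              (insert notin 1 ab; simp only: kunz_set_mem not_less; linarith)))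
    next
      case 2
      show False
        by (cases x rule: nat_mod_3_cases; cases y rule: nat_mod_3_cases;
            ((insert 2(2); presburger) |
              (insert notin 2 ab; simp only: kunz_set_mem not_less; linarith)))
    qed
  qed
  moreover have "finite (kunz_set a b)" by (simp add: kunz_set_def)
  moreover have "0 \<notin> kunz_set a b" using kunz_set_mem(1)[of 0] by simp
  ultimately show "gapset (kunz_set a b)" unfolding gapset_def by blast
qed

lemma gapset_multiplicity_eq_3_iff:
  assumes "gapset G"
  shows "gapset_multiplicity G = 3 \<longleftrightarrow> 1 \<in> G \<and> 2 \<in> G \<and> 3 \<notin> G"
proof
  assume eq: "gapset_multiplicity G = 3"
  have "x \<in> G" if "1 \<le> x" "x < 3" for x
    using that not_less_Least[of x "\<lambda>m. 1 \<le> m \<and> m \<notin> G"] eq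
    unfolding gapset_multiplicity_def by simp
  then show "1 \<in> G \<and> 2 \<in> G \<and> 3 \<notin> G"
    using gapset_multiplicity_props(2)[OF assms] eq by simp
next
  assume G: "1 \<in> G \<and> 2 \<in> G \<and> 3 \<notin> G"
  show "gapset_multiplicity G = 3"
    unfolding gapset_multiplicity_def
  proof (rule Least_equality)
    fix y :: nat
    assume y: "1 \<le> y \<and> y \<notin> G"
    then have "y \<noteq> 1" "y \<noteq> 2" using G by auto
    with y show "3 \<le> y" by linarith
  qed (use G in simp)
qed

lemma gapset_multiplicity_kunz_set_iff:
  assumes "gapset (kunz_set a b)"
  shows "gapset_multiplicity (kunz_set a b) = 3 \<longleftrightarrow> 1 \<le> a \<and> 1 \<le> b"
  unfolding gapset_multiplicity_eq_3_iff[OF assms]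
  using kunz_set_mem(1)[of 1] kunz_set_mem(2,3)[of 0 a b] by (auto simp: numeral_2_eq_2)

lemma finite_down_closed_eq_lessThan:
  fixes A :: "nat set"
  assumes "finite A" "\<And>i. Suc i \<in> A \<Longrightarrow> i \<in> A"
  shows "A = {..<card A}"
proof -
  have down: "i + k \<in> A \<Longrightarrow> i \<in> A" for i k
    by (induction k) (auto intro: assms(2))
  obtain n where n: "n \<notin> A" "\<And>i. i < n \<Longrightarrow> i \<in> A"
  proof
    show "(LEAST n. n \<notin> A) \<notin> A"
      using ex_new_if_finite[OF infinite_UNIV_nat assms(1)] by (metis LeastI)
    show "i \<in> A" if "i < (LEAST n. n \<notin> A)" for i
      using not_less_Least[OF that] by simp
  qed
  have "i < n" if "i \<in> A" for i
    using that n(1) down[of n "i - n"] by (cases "i < n") auto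
  with n(2) have "A = {..<n}" by auto
  then show ?thesis by simp
qed

text \<open>
  A gap greater than 3 remains a gap after subtracting 3, so in each nonzero class modulo 3 the
  gaps form an initial segment.
\<close>

lemma gapset_eq_kunz_set:
  assumes G: "gapset G" "gapset_multiplicity G = 3"
  shows "\<exists>a b. G = kunz_set a b"
proof -
  have initial: "\<exists>n. \<forall>i. 3 * i + r \<in> G \<longleftrightarrow> i < n" if "1 \<le> r" for r
  proof -
    let ?A = "{i. 3 * i + r \<in> G}"
    have "inj (\<lambda>i. 3 * i + r)" by (simp add: inj_on_def)
    then have "finite ?A"
      using finite_vimageI[of G "\<lambda>i. 3 * i + r"] G(1) by (simp add: vimage_def gapset_def)
    moreover have "i \<in> ?A" if "Suc i \<in> ?A" for i
      using that gapset_minus_multiplicity[OF G(1), of "3 * i + r"] G(2) \<open>1 \<le> r\<close>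
      by (simp add: algebra_simps)
    ultimately have "?A = {..<card ?A}" by (rule finite_down_closed_eq_lessThan)
    then show ?thesis by blast
  qed
  obtain a where a: "\<And>i. 3 * i + 1 \<in> G \<longleftrightarrow> i < a" using initial[of 1] by auto
  obtain b where b: "\<And>i. 3 * i + 2 \<in> G \<longleftrightarrow> i < b" using initial[of 2] by auto
  have "x \<in> G \<longleftrightarrow> x \<in> kunz_set a b" for x
  proof (cases x rule: nat_mod_3_cases)
    case (1 i)
    then show ?thesis
      using mult_multiplicity_notin_gapset[OF G(1), of i] G(2) kunz_set_mem(1)[of i a b]
      by (simp add: mult.commute)
  next
    case (2 i)
    then show ?thesis using a kunz_set_mem(2) by simp
  next
    case (3 i)
    then show ?thesis using b kunz_set_mem(3) by simp
  qed
  then show ?thesis by blast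
qed

text \<open>
  The lower bounds 1 in \<open>kunz_points\<close> express that 1 and 2 are gaps, so that the multiplicity is
  exactly 3; the two other inequalities are closure under addition, and \<open>a + b\<close> is the genus.
\<close>

lemma bij_betw_kunz_points: "bij_betw (\<lambda>(a, b). kunz_set a b) (kunz_points g) (gapsets g 3)"
proof -
  have kunz_set_in: "kunz_set a b \<in> gapsets g 3 \<longleftrightarrow> (a, b) \<in> kunz_points g" for a b
    using gapset_kunz_set_iff[of a b] gapset_multiplicity_kunz_set_iff[of a b]
    by (auto simp: gapsets_def kunz_points_def gapset_genus_def card_kunz_set)
  have "G \<in> (\<lambda>(a, b). kunz_set a b) ` kunz_points g" if G: "G \<in> gapsets g 3" for G
  proof -
    obtain a b where "G = kunz_set a b"
      using G gapset_eq_kunz_set[of G] unfolding gapsets_def by blast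
    with G kunz_set_in show ?thesis by force
  qed
  then show ?thesis
    unfolding bij_betw_def by (auto simp: inj_on_def kunz_set_inject kunz_set_in)
qed

section \<open>Monotonicity in the genus\<close>

lemma finite_kunz_points: "finite (kunz_points g)"
  by (rule finite_subset[of _ "{..g} \<times> {..g}"]) (auto simp: kunz_points_def)

text \<open>
  The translation by \<open>(1, 0)\<close> leaves the cone only at \<open>(2 b + 1, b)\<close>, where \<open>g = 3 b + 1\<close>, so it
  can be used when 3 divides \<open>g\<close>. The translation by \<open>(0, 1)\<close> leaves it only at \<open>(a, 2 a)\<close>,
  where \<open>g = 3 a\<close>, so it can be used in all other cases.
\<close>

lemma card_kunz_points_mono: "card (kunz_points g) \<le> card (kunz_points (g + 1))"
proof (cases "3 dvd g")
  case True
  then have "(\<lambda>(a, b). (a + 1, b)) ` kunz_points g \<subseteq> kunz_points (g + 1)"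
    unfolding kunz_points_def by auto presburger
  moreover have "inj_on (\<lambda>(a, b). (a + 1, b)) (kunz_points g)" by (auto simp: inj_on_def)
  ultimately show ?thesis using card_inj_on_le finite_kunz_points by blast
next
  case False
  then have "(\<lambda>(a, b). (a, b + 1)) ` kunz_points g \<subseteq> kunz_points (g + 1)"
    unfolding kunz_points_def by auto presburger
  moreover have "inj_on (\<lambda>(a, b). (a, b + 1)) (kunz_points g)" by (auto simp: inj_on_def)
  ultimately show ?thesis using card_inj_on_le finite_kunz_points by blast
qed

theorem corollary3p2:
  fixes g :: nat
  shows "(\<exists>f. inj_on f (gapset_filtrations g 3) \<and>
              f ` gapset_filtrations g 3 \<subseteq> gapset_filtrations (g + 1) 3)
         \<and> num_semigroups (g + 1) 3 \<ge> num_semigroups g 3"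
proof -
  have fin: "finite (gapset_filtrations h 3)" for h
  proof -
    have "finite (gapsets h 3)"
      using bij_betw_finite[OF bij_betw_kunz_points] finite_kunz_points by blast
    then show ?thesis by (simp add: gapset_filtrations_def gapsets_def)
  qed
  have le: "card (gapsets g 3) \<le> card (gapsets (g + 1) 3)"
    using card_kunz_points_mono[of g] by (simp only: bij_betw_same_card[OF bij_betw_kunz_points])
  have "\<exists>f. f ` gapset_filtrations g 3 \<subseteq> gapset_filtrations (g + 1) 3 \<and>
      inj_on f (gapset_filtrations g 3)"
    using card_le_inj[OF fin fin] le by (simp only: card_gapset_filtrations)
  then show ?thesis using le by (auto simp: num_semigroups_eq_card_gapsets)
qed

end
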